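(* Let $L>0$, $f\in\mathcal F_L(\mathbb R^n)$, $x_0\in\mathbb R^n$, and let $(x_k)_{k\in\mathbb N}$ be the trajectory of gradient descent $x_{k+1}:=x_k-\eta_k\nabla f(x_k)$ with initial point $x_0$ and step sizes satisfying $0<\eta_i\le 1/L$ for all $i$. Let $a_k:=\sum_{i=0}^{k-1}\eta_i$. Then: (a) If $\eta_i=1/L$ for all $i$, then $\|\nabla f(x_k)\|^2-\|p\|^2\le\frac{2LD_f(x_0,p)}{k}$ for all $p\in\operatorname{dom} f^*$ and all $k\ge1$. (b) If the step sizes are chosen so that $a_k\to\infty$, then $\nabla f(x_k)$ converges to the minimum-norm point of $\overline{\operatorname{dom} f^*}$. (c) If $\operatorname{dom} f^*$ has a minimum-norm point $p^\star$, then $\|\nabla f(x_k)-p^\star\|^2\le\frac{2D_f(x_0,p^\star)}{a_k}$ for all $k\ge1$. (d) In particular, if $\operatorname{dom} f^*$ has a minimum-norm point $p^\star$ and $\eta_i=1/L$ for all $i$, then for all $k\ge1$ $$\|\nabla f(x_k)-p^\star\|^2\le\|\nabla f(x_k)\|^2-\|p^\star\|^2\le\frac{2LD_f(x_0,p^\star)}{k}.$$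
   Context: $\|\cdot\|$ and $\langle\cdot,\cdot\rangle$ are the Euclidean norm and inner product on $\mathbb R^n$. For $L>0$, $\mathcal F_L(\mathbb R^n)$ is the set of finite-valued differentiable convex functions $f:\mathbb R^n\to\mathbb R$ whose gradient is $L$-Lipschitz. The Legendre--Fenchel conjugate is $f^*(p):=\sup_{x\in\mathbb R^n}\{\langle p,x\rangle-f(x)\}\in\mathbb R\cup\{\infty\}$, and $\operatorname{dom} f^*:=\{p\in\mathbb R^n: f^*(p)<\infty\}$; it is a nonempty convex set, so its closure $\overline{\operatorname{dom} f^*}$ has a unique minimum-norm point. The dual divergence is $D_f(x,p):=f(x)+f^*(p)-\langle p,x\rangle$. *)

theory Defs
  imports "HOL-Analysis.Analysis"
begin

definition gradient :: "(real ^ 'n \<Rightarrow> real) \<Rightarrow> real ^ 'n \<Rightarrow> real ^ 'n" where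
  "gradient f x = (THE g. GDERIV f x :> g)"

lemma gradient_eqI:
  fixes f :: "real ^ 'n \<Rightarrow> real"
  assumes "GDERIV f x :> g"
  shows "gradient f x = g"
  unfolding gradient_def
proof (rule the_equality)
  show "GDERIV f x :> g"
    by (fact assms)
next
  fix h assume "GDERIV f x :> h"
  then have "(\<lambda>v. v \<bullet> h) = (\<lambda>v. v \<bullet> g)"
    using assms unfolding gderiv_def by (rule has_derivative_unique)
  then have "\<forall>v. v \<bullet> h = v \<bullet> g"
    by meson
  then show "h = g"
    by (simp only: vector_eq_ldot)
qed

lemma gradient_works:
  fixes f :: "real ^ 'n \<Rightarrow> real"
  assumes "f differentiable (at x)"
  shows "GDERIV f x :> gradient f x"
proof -
  obtain f' where f': "(f has_derivative f') (at x)"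
    using assms by (auto simp: differentiable_def)
  interpret linear f'
    using f' by (rule has_derivative_linear)
  have "f' = (\<lambda>v. v \<bullet> adjoint f' 1)"
    using adjoint_works[OF linear_axioms, of _ 1] by (auto simp: fun_eq_iff)
  then have "GDERIV f x :> adjoint f' 1"
    using f' unfolding gderiv_def by simp
  then show ?thesis
    using gradient_eqI by metis
qed

definition convex_smooth :: "real \<Rightarrow> (real ^ 'n \<Rightarrow> real) set" where
  "convex_smooth L = {f. convex_on UNIV f \<and> (\<forall>x. f differentiable (at x)) \<and>
                         L-lipschitz_on UNIV (gradient f)}"

definition fenchel_conj :: "(real ^ 'n \<Rightarrow> real) \<Rightarrow> real ^ 'n \<Rightarrow> ereal" where
  "fenchel_conj f p = (SUP x. ereal (p \<bullet> x - f x))"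

definition conj_dom :: "(real ^ 'n \<Rightarrow> real) \<Rightarrow> (real ^ 'n) set" where
  "conj_dom f = {p. fenchel_conj f p < \<infinity>}"

definition dual_div :: "(real ^ 'n \<Rightarrow> real) \<Rightarrow> real ^ 'n \<Rightarrow> real ^ 'n \<Rightarrow> ereal" where
  "dual_div f x p = ereal (f x) + fenchel_conj f p - ereal (p \<bullet> x)"

lemma conj_dom_iff: "p \<in> conj_dom f \<longleftrightarrow> (\<exists>B. \<forall>x. p \<bullet> x - f x \<le> B)"
proof
  assume "p \<in> conj_dom f"
  then obtain B where "fenchel_conj f p < ereal B"
    unfolding conj_dom_def using less_PInf_Ex_of_nat by (auto intro: that)
  moreover have "ereal (p \<bullet> x - f x) \<le> fenchel_conj f p" for x
    unfolding fenchel_conj_def by (rule SUP_upper) simp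
  ultimately have "ereal (p \<bullet> x - f x) \<le> ereal B" for x
    by (meson less_imp_le order_trans)
  then show "\<exists>B. \<forall>x. p \<bullet> x - f x \<le> B"
    by auto
next
  assume "\<exists>B. \<forall>x. p \<bullet> x - f x \<le> B"
  then obtain B where "\<And>x. p \<bullet> x - f x \<le> B"
    by blast
  then have "fenchel_conj f p \<le> ereal B"
    unfolding fenchel_conj_def by (intro SUP_least) simp
  then show "p \<in> conj_dom f"
    unfolding conj_dom_def by (auto intro: le_less_trans)
qed

lemma convex_conj_dom:
  fixes f :: "real ^ 'n \<Rightarrow> real"
  shows "convex (conj_dom f)"
proof (rule convexI)
  fix p q :: "real ^ 'n" and u v :: real
  assume "p \<in> conj_dom f" "q \<in> conj_dom f" and uv: "0 \<le> u" "0 \<le> v" "u + v = 1"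
  then obtain B C where "\<And>x. p \<bullet> x - f x \<le> B" "\<And>x. q \<bullet> x - f x \<le> C"
    unfolding conj_dom_iff by blast
  then have "u * (p \<bullet> x - f x) + v * (q \<bullet> x - f x) \<le> u * B + v * C" for x
    using uv by (intro add_mono mult_left_mono)
  moreover have "u * (p \<bullet> x - f x) + v * (q \<bullet> x - f x) = (u *\<^sub>R p + v *\<^sub>R q) \<bullet> x - (u + v) * f x" for x
    by (simp add: inner_add_left algebra_simps)
  ultimately show "u *\<^sub>R p + v *\<^sub>R q \<in> conj_dom f"
    unfolding conj_dom_iff using uv by auto
qed

lemma gradient_in_conj_dom:
  assumes "convex_on UNIV f" "f differentiable (at x)"
  shows "gradient f x \<in> conj_dom f"
proof -
  have "gradient f x \<bullet> y - f y \<le> gradient f x \<bullet> x - f x" for y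
  proof -
    define \<phi> where "\<phi> t = f (x + t *\<^sub>R (y - x))" for t :: real
    have "convex_on UNIV \<phi>"
    proof (rule convex_onI)
      fix t a b :: real assume t: "0 < t" "t < 1"
      have "\<phi> ((1 - t) *\<^sub>R a + t *\<^sub>R b)
          = f ((1 - t) *\<^sub>R (x + a *\<^sub>R (y - x)) + t *\<^sub>R (x + b *\<^sub>R (y - x)))"
        unfolding \<phi>_def by (simp add: algebra_simps)
      also have "\<dots> \<le> (1 - t) * \<phi> a + t * \<phi> b"
        unfolding \<phi>_def using t by (intro convex_onD[OF assms(1)]) auto
      finally show "\<phi> ((1 - t) *\<^sub>R a + t *\<^sub>R b) \<le> (1 - t) * \<phi> a + t * \<phi> b" .
    qed simp
    moreover have "(\<phi> has_real_derivative (y - x) \<bullet> gradient f x) (at 0)"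
    proof -
      have line: "((\<lambda>t. x + t *\<^sub>R (y - x)) has_derivative (\<lambda>t. t *\<^sub>R (y - x))) (at (0::real))"
        by (auto intro!: derivative_eq_intros)
      have "(f has_derivative (\<lambda>v. v \<bullet> gradient f x)) (at (x + 0 *\<^sub>R (y - x)))"
        using gradient_works[OF assms(2)] by (simp add: gderiv_def)
      from has_derivative_compose[OF line this] show ?thesis
        unfolding \<phi>_def by (simp add: has_field_derivative_def mult.commute[of _ "(y - x) \<bullet> gradient f x"])
    qed
    ultimately have "\<phi> 1 - \<phi> 0 \<ge> ((y - x) \<bullet> gradient f x) * (1 - 0)"
      by (intro convex_on_imp_above_tangent[where A = UNIV]) auto
    then show ?thesis
      by (simp add: \<phi>_def inner_diff_left inner_diff_right inner_commute[of _ "gradient f x"])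
  qed
  then show ?thesis
    unfolding conj_dom_iff by blast
qed

text \<open>The minimum-norm point of the closure of the domain is written with \<^const>\<open>arg_min\<close>,
  a choice operator; the following fact shows that the choice is well defined.\<close>

lemma ex1_min_norm_closure_conj_dom:
  assumes "f \<in> convex_smooth L"
  shows "\<exists>!p. is_arg_min norm (\<lambda>p. p \<in> closure (conj_dom f)) p"
proof -
  let ?C = "closure (conj_dom f)"
  have C: "convex ?C" "closed ?C" "?C \<noteq> {}"
    using assms gradient_in_conj_dom[of f] convex_conj_dom[of f]
    by (auto simp: convex_smooth_def intro: convex_closure)
  show ?thesis
  proof (rule ex1I)
    show "is_arg_min norm (\<lambda>p. p \<in> ?C) (closest_point ?C 0)"
      using closest_point_exists[OF C(2,3), of 0] by (simp add: is_arg_min_linorder)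
  next
    fix q assume "is_arg_min norm (\<lambda>p. p \<in> ?C) q"
    then show "q = closest_point ?C 0"
      using C(1,2) by (intro closest_point_unique) (auto simp: is_arg_min_linorder)
  qed
qed

end

theory Submission
  imports Defs
begin

text \<open>Write \<open>g k\<close> for the gradient at \<open>x k\<close>. Cocoercivity of the gradient, applied between consecutive
  iterates with step at most \<open>1 / L\<close>, gives
  \<open>f (x (k+1)) - f (x k) \<le> - \<eta> k / 2 * (|g k|\<^sup>2 + |g (k+1)|\<^sup>2)\<close>, and after adding the linear term
  \<open>D (x (k+1)) p - D (x k) p \<le> \<eta> k / 2 * (|p|\<^sup>2 - |g (k+1)|\<^sup>2)\<close>. As \<open>|g k|\<close> is nonincreasing and
  \<open>D\<close> is nonnegative, telescoping yields \<open>a k * (|g k|\<^sup>2 - |p|\<^sup>2) \<le> 2 * D x0 p\<close> for all \<open>p\<close>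
  in the domain of the conjugate. Every \<open>g k\<close> lies in this convex domain, so \<open>|g k - q|\<^sup>2 \<le> |g k|\<^sup>2 - |q|\<^sup>2\<close>
  for the minimum-norm point \<open>q\<close> of the domain or of its closure, which turns the bound on norms
  into a bound on distances.\<close>

section \<open>Inequalities for convex functions with Lipschitz gradient\<close>

lemma has_real_derivative_along_line:
  fixes f :: "real ^ 'n \<Rightarrow> real"
  assumes "\<And>x. f differentiable (at x)"
  shows "((\<lambda>t. f (x + t *\<^sub>R d)) has_real_derivative d \<bullet> gradient f (x + t *\<^sub>R d)) (at t)"
proof -
  have line: "((\<lambda>t. x + t *\<^sub>R d) has_derivative (\<lambda>t. t *\<^sub>R d)) (at t)"
    by (auto intro!: derivative_eq_intros)
  have "(f has_derivative (\<lambda>v. v \<bullet> gradient f (x + t *\<^sub>R d))) (at (x + t *\<^sub>R d))"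
    using gradient_works[OF assms] by (simp add: gderiv_def)
  from has_derivative_compose[OF line this] show ?thesis
    by (simp add: has_field_derivative_def mult.commute[of _ "d \<bullet> _"])
qed

text \<open>The restriction of \<open>f\<close> to the line through \<open>x\<close> and
  \<open>y\<close> is convex, so the one-variable tangent inequality at 0, read at 1,
  suffices.\<close>

lemma convex_above_tangent:
  fixes f :: "real ^ 'n \<Rightarrow> real"
  assumes "convex_on UNIV f" "\<And>x. f differentiable (at x)"
  shows "f x + gradient f x \<bullet> (y - x) \<le> f y"
proof -
  define \<phi> where "\<phi> t = f (x + t *\<^sub>R (y - x))" for t :: real
  have "convex_on UNIV \<phi>"
  proof (rule convex_onI)
    fix t a b :: real assume t: "0 < t" "t < 1"
    have "\<phi> ((1 - t) *\<^sub>R a + t *\<^sub>R b)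
        = f ((1 - t) *\<^sub>R (x + a *\<^sub>R (y - x)) + t *\<^sub>R (x + b *\<^sub>R (y - x)))"
      unfolding \<phi>_def by (simp add: algebra_simps)
    also have "\<dots> \<le> (1 - t) * \<phi> a + t * \<phi> b"
      unfolding \<phi>_def using t by (intro convex_onD[OF assms(1)]) auto
    finally show "\<phi> ((1 - t) *\<^sub>R a + t *\<^sub>R b) \<le> (1 - t) * \<phi> a + t * \<phi> b" .
  qed simp
  moreover have "(\<phi> has_real_derivative (y - x) \<bullet> gradient f x) (at 0)"
    using has_real_derivative_along_line[OF assms(2), of x "y - x" 0] by (simp add: \<phi>_def[abs_def])
  ultimately have "\<phi> 1 - \<phi> 0 \<ge> ((y - x) \<bullet> gradient f x) * (1 - 0)"
    by (intro convex_on_imp_above_tangent[where A = UNIV]) auto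
  then show ?thesis
    by (simp add: \<phi>_def inner_commute)
qed

text \<open>The descent lemma. Integration along the segment is avoided: \<open>\<psi>\<close>,
  which is \<open>f\<close> on the segment minus the linear and quadratic terms of the model, has
  nonpositive derivative on [0,1].\<close>

lemma lipschitz_gradient_upper_bound:
  fixes f :: "real ^ 'n \<Rightarrow> real"
  assumes diff: "\<And>x. f differentiable (at x)" and lip: "L-lipschitz_on UNIV (gradient f)"
  shows "f y \<le> f x + gradient f x \<bullet> (y - x) + L / 2 * (norm (y - x))\<^sup>2"
proof -
  define d where "d = y - x"
  define \<psi> where "\<psi> t = f (x + t *\<^sub>R d) - t * (d \<bullet> gradient f x) - L / 2 * t\<^sup>2 * (norm d)\<^sup>2" for t
  have "\<psi> 0 \<ge> \<psi> 1"
  proof (rule DERIV_nonpos_imp_nonincreasing[of 0 1])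
    fix t :: real assume t: "0 \<le> t" "t \<le> 1"
    define D where "D = d \<bullet> gradient f (x + t *\<^sub>R d) - d \<bullet> gradient f x - L * t * (norm d)\<^sup>2"
    have "(\<psi> has_real_derivative D) (at t)"
      unfolding \<psi>_def[abs_def] D_def
      by (rule derivative_eq_intros has_real_derivative_along_line[OF diff] refl | simp)+
    moreover have "D \<le> 0"
    proof -
      have "d \<bullet> (gradient f (x + t *\<^sub>R d) - gradient f x)
          \<le> norm d * norm (gradient f (x + t *\<^sub>R d) - gradient f x)"
        by (rule norm_cauchy_schwarz)
      also have "\<dots> \<le> norm d * (L * (t * norm d))"
        using lipschitz_onD[OF lip, of "x + t *\<^sub>R d" x] t
        by (intro mult_left_mono) (auto simp: dist_norm)
      finally show ?thesis
        by (simp add: D_def inner_diff_right power2_eq_square mult_ac)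
    qed
    ultimately show "\<exists>y. (\<psi> has_real_derivative y) (at t) \<and> y \<le> 0"
      by blast
  qed simp
  then show ?thesis
    by (simp add: \<psi>_def d_def inner_commute)
qed

text \<open>Subtracting from \<open>f\<close> its tangent at \<open>x\<close> leaves a function that
  is minimal at \<open>x\<close>; a gradient step on it from \<open>y\<close> must stay above that
  minimum, which bounds the gradient \<open>w\<close> at \<open>y\<close>.\<close>

lemma convex_smooth_lower_bound:
  fixes f :: "real ^ 'n \<Rightarrow> real"
  assumes "L > 0" "f \<in> convex_smooth L"
  shows "f x + gradient f x \<bullet> (y - x) + (norm (gradient f y - gradient f x))\<^sup>2 / (2 * L) \<le> f y"
proof -
  have f: "convex_on UNIV f" "\<And>x. f differentiable (at x)" "L-lipschitz_on UNIV (gradient f)"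
    using assms(2) by (auto simp: convex_smooth_def)
  define w where "w = gradient f y - gradient f x"
  \<comment> \<open>This point minimizes the quadratic upper bound at \<open>y\<close> minus the
    tangent at \<open>x\<close>.\<close>
  define z where "z = y - (1 / L) *\<^sub>R w"
  have "f x + gradient f x \<bullet> (z - x) \<le> f z"
    by (rule convex_above_tangent[OF f(1,2)])
  also have "\<dots> \<le> f y + gradient f y \<bullet> (z - y) + L / 2 * (norm (z - y))\<^sup>2"
    by (rule lipschitz_gradient_upper_bound[OF f(2,3)])
  finally have *: "f x + gradient f x \<bullet> (z - x)
      \<le> f y + gradient f y \<bullet> (z - y) + L / 2 * (norm (z - y))\<^sup>2" .
  \<comment> \<open>The linear terms gain \<open>(norm w)\<^sup>2 / L\<close>; the quadratic term
    costs half of it.\<close>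
  have "gradient f x \<bullet> (z - x) - gradient f y \<bullet> (z - y)
      = gradient f x \<bullet> (y - x) + (norm w)\<^sup>2 / L"
    by (simp add: z_def power2_norm_eq_inner inner_diff_right inner_diff_left w_def diff_divide_distrib)
  moreover have "L / 2 * (norm (z - y))\<^sup>2 = (norm w)\<^sup>2 / (2 * L)"
    using assms(1) by (simp add: z_def power2_eq_square field_simps)
  moreover have "(norm w)\<^sup>2 / L = (norm w)\<^sup>2 / (2 * L) + (norm w)\<^sup>2 / (2 * L)"
    by simp
  ultimately show ?thesis
    using * unfolding w_def by linarith
qed

section \<open>Estimates for a single gradient step\<close>

lemma gradient_step_decrease:
  fixes f :: "real ^ 'n \<Rightarrow> real"
  assumes "L > 0" "f \<in> convex_smooth L" and step: "0 < s" "s \<le> 1 / L"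
    and y: "y = x - s *\<^sub>R gradient f x"
  shows "f y - f x \<le> - (s / 2) * ((norm (gradient f x))\<^sup>2 + (norm (gradient f y))\<^sup>2)"
proof -
  let ?g = "gradient f x" and ?h = "gradient f y"
  \<comment> \<open>The base point is the new iterate \<open>y\<close>, and \<open>x - y\<close>
    equals \<open>s\<close> times \<open>?g\<close>.\<close>
  have "f y + s * (?h \<bullet> ?g) + (norm (?g - ?h))\<^sup>2 / (2 * L) \<le> f x"
    using convex_smooth_lower_bound[OF assms(1,2), of y x] y by simp
  \<comment> \<open>With the coefficient lowered to \<open>s / 2\<close>, the cross term of the
    square cancels \<open>s * (?h \<bullet> ?g)\<close> exactly.\<close>
  moreover have "s / 2 * (norm (?g - ?h))\<^sup>2 \<le> (norm (?g - ?h))\<^sup>2 / (2 * L)"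
    using mult_right_mono[OF step(2), of "(norm (?g - ?h))\<^sup>2"] by simp
  moreover have "s / 2 * (norm (?g - ?h))\<^sup>2
      = s / 2 * ((norm ?g)\<^sup>2 + (norm ?h)\<^sup>2) - s * (?h \<bullet> ?g)"
    unfolding power2_norm_eq_inner
    by (simp add: inner_diff_left inner_diff_right inner_commute algebra_simps)
  ultimately show ?thesis
    by simp
qed

text \<open>Adding the lower bound in both directions gives cocoercivity; since \<open>s\<close> is
  at most \<open>1 / L\<close>, this becomes \<open>(norm ?h)\<^sup>2 \<le> ?h \<bullet> ?g\<close>,
  and Cauchy-Schwarz finishes.\<close>

lemma gradient_step_norm_le:
  fixes f :: "real ^ 'n \<Rightarrow> real"
  assumes "L > 0" "f \<in> convex_smooth L" and step: "0 < s" "s \<le> 1 / L"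
    and y: "y = x - s *\<^sub>R gradient f x"
  shows "norm (gradient f y) \<le> norm (gradient f x)"
proof -
  let ?g = "gradient f x" and ?h = "gradient f y"
  have "f y + s * (?h \<bullet> ?g) + (norm (?g - ?h))\<^sup>2 / (2 * L) \<le> f x"
    using convex_smooth_lower_bound[OF assms(1,2), of y x] y by simp
  moreover have "f x - s * (?g \<bullet> ?g) + (norm (?g - ?h))\<^sup>2 / (2 * L) \<le> f y"
    using convex_smooth_lower_bound[OF assms(1,2), of x y] y by (simp add: norm_minus_commute)
  moreover have "s / 2 * (norm (?g - ?h))\<^sup>2 \<le> (norm (?g - ?h))\<^sup>2 / (2 * L)"
    using mult_right_mono[OF step(2), of "(norm (?g - ?h))\<^sup>2"] by simp
  ultimately have "s * (norm (?g - ?h))\<^sup>2 \<le> s * (?g \<bullet> ?g - ?h \<bullet> ?g)"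
    by (simp add: right_diff_distrib)
  then have "(norm (?g - ?h))\<^sup>2 \<le> ?g \<bullet> ?g - ?h \<bullet> ?g"
    using step(1) by simp
  then have "(norm ?h)\<^sup>2 \<le> ?h \<bullet> ?g"
    by (simp add: power2_norm_eq_inner inner_diff_left inner_diff_right inner_commute)
  also have "\<dots> \<le> norm ?h * norm ?g"
    by (rule norm_cauchy_schwarz)
  finally have "norm ?h * norm ?h \<le> norm ?h * norm ?g"
    by (simp add: power2_eq_square)
  then show ?thesis
    by (cases "?h = 0") auto
qed

section \<open>Real-valued dual divergence and the telescoped bound\<close>

lemma conj_dom_dual_div:
  fixes f :: "real ^ 'n \<Rightarrow> real"
  assumes "p \<in> conj_dom f"
  shows "\<exists>r. \<forall>y. dual_div f y p = ereal (f y + r - p \<bullet> y) \<and> 0 \<le> f y + r - p \<bullet> y"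
proof -
  have ge: "ereal (p \<bullet> y - f y) \<le> fenchel_conj f p" for y
    unfolding fenchel_conj_def by (rule SUP_upper) simp
  \<comment> \<open>Membership in the domain excludes \<infinity>, the value at 0 excludes
    -\<infinity>. The same \<open>r\<close> serves every \<open>y\<close>.\<close>
  obtain r where r: "fenchel_conj f p = ereal r"
    using assms ge[of 0] unfolding conj_dom_def by (cases "fenchel_conj f p") auto
  then show ?thesis
    using ge by (intro exI[of _ r]) (simp add: dual_div_def r algebra_simps)
qed

text \<open>Here \<open>r\<close> may be any real upper bound for the conjugate at \<open>p\<close>,
  which keeps the argument within the reals.\<close>

lemma gradient_descent_norm_bound:
  fixes f :: "real ^ 'n \<Rightarrow> real"
  assumes "L > 0" "f \<in> convex_smooth L"
    and x: "\<And>k. x (Suc k) = x k - \<eta> k *\<^sub>R gradient f (x k)"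
    and \<eta>: "\<And>i. 0 < \<eta> i \<and> \<eta> i \<le> 1 / L"
    and r: "\<And>y. 0 \<le> f y + r - p \<bullet> y"
  shows "(\<Sum>i<k. \<eta> i) * ((norm (gradient f (x k)))\<^sup>2 - (norm p)\<^sup>2) \<le> 2 * (f (x 0) + r - p \<bullet> x 0)"
proof -
  define N where "N k = (norm (gradient f (x k)))\<^sup>2 - (norm p)\<^sup>2" for k
  define D where "D k = f (x k) + r - p \<bullet> x k" for k
  have N_Suc: "N (Suc k) \<le> N k" for k
    using gradient_step_norm_le[OF assms(1,2) _ _ x[of k]] \<eta>[of k]
    by (auto simp: N_def intro!: power_mono)
  have D_Suc: "2 * D (Suc k) + \<eta> k * N (Suc k) \<le> 2 * D k" for k
  proof -
    let ?g = "gradient f (x k)" and ?h = "gradient f (x (Suc k))"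
    have "f (x (Suc k)) - f (x k) \<le> - (\<eta> k / 2) * ((norm ?g)\<^sup>2 + (norm ?h)\<^sup>2)"
      using gradient_step_decrease[OF assms(1,2) _ _ x[of k]] \<eta>[of k] by blast
    moreover have "D (Suc k) - D k = f (x (Suc k)) - f (x k) + \<eta> k * (p \<bullet> ?g)"
      by (simp add: D_def x inner_diff_right)
    \<comment> \<open>Young's inequality for \<open>p \<bullet> ?g\<close>: its
      \<open>(norm ?g)\<^sup>2\<close> cancels the one in the decrease, so only the new gradient
      remains.\<close>
    moreover have "0 \<le> \<eta> k * (norm (p - ?g))\<^sup>2"
      using \<eta>[of k] by simp
    moreover have "\<eta> k * (norm (p - ?g))\<^sup>2
        = \<eta> k * (norm p)\<^sup>2 + \<eta> k * (norm ?g)\<^sup>2 - 2 * (\<eta> k * (p \<bullet> ?g))"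
      unfolding power2_norm_eq_inner
      by (simp add: inner_diff_left inner_diff_right inner_commute algebra_simps)
    ultimately show ?thesis
      by (simp add: N_def field_simps)
  qed
  have "2 * D k + (\<Sum>i<k. \<eta> i) * N k \<le> 2 * D 0"
  proof (induction k)
    case (Suc k)
    \<comment> \<open>Monotonicity of \<open>N\<close> moves all earlier weights onto the newest
      gradient.\<close>
    have "(\<Sum>i<k. \<eta> i) * N (Suc k) \<le> (\<Sum>i<k. \<eta> i) * N k"
      using \<eta> N_Suc by (intro mult_left_mono sum_nonneg) (auto intro: less_imp_le)
    then show ?case
      using Suc D_Suc[of k] by (simp add: distrib_right)
  qed simp
  then show ?thesis
    using r[of "x k"] by (simp add: N_def D_def)
qed

section \<open>Minimum-norm points and convergence of the gradients\<close>

lemma dist_min_norm_point_le: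
  fixes q :: "'a::euclidean_space"
  assumes "convex C" "is_arg_min norm (\<lambda>p. p \<in> C) q" "g \<in> C"
  shows "(norm (g - q))\<^sup>2 \<le> (norm g)\<^sup>2 - (norm q)\<^sup>2"
proof -
  have q: "q \<in> C" "\<forall>z\<in>C. dist 0 q \<le> dist 0 z"
    using assms(2) by (auto simp: is_arg_min_linorder)
  \<comment> \<open>\<open>C\<close> need not be closed, but the segment is.\<close>
  have "closed_segment q g \<subseteq> C"
    using assms(1,3) q(1) by (simp add: closed_segment_subset)
  \<comment> \<open>Since \<open>q\<close> is the point of the segment closest to 0, the variational
    inequality of the projection applies.\<close>
  then have "(0 - q) \<bullet> (g - q) \<le> 0"
    using q(2) by (intro any_closest_point_dot[of "closed_segment q g"]) auto
  then show ?thesis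
    by (simp add: power2_norm_eq_inner inner_diff_left inner_diff_right inner_commute)
qed

lemma gradient_descent_gradient_tendsto:
  fixes f :: "real ^ 'n \<Rightarrow> real"
  assumes "L > 0" "f \<in> convex_smooth L"
    and x: "\<And>k. x (Suc k) = x k - \<eta> k *\<^sub>R gradient f (x k)"
    and \<eta>: "\<And>i. 0 < \<eta> i \<and> \<eta> i \<le> 1 / L"
    and lim: "filterlim (\<lambda>k. \<Sum>i<k. \<eta> i) at_top sequentially"
    and q: "is_arg_min norm (\<lambda>p. p \<in> closure (conj_dom f)) q"
  shows "(\<lambda>k. gradient f (x k)) \<longlonglongrightarrow> q"
proof -
  let ?g = "\<lambda>k. gradient f (x k)"
  have dist: "(norm (?g k - q))\<^sup>2 \<le> (norm (?g k))\<^sup>2 - (norm q)\<^sup>2" for k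
  proof (rule dist_min_norm_point_le[OF _ q])
    show "convex (closure (conj_dom f))"
      by (intro convex_closure convex_conj_dom)
    show "?g k \<in> closure (conj_dom f)"
      using assms(2) gradient_in_conj_dom[of f] closure_subset by (auto simp: convex_smooth_def)
  qed
  have "(\<lambda>k. (norm (?g k - q))\<^sup>2) \<longlonglongrightarrow> 0"
  proof (rule order_tendstoI)
    fix e :: real assume "e < 0"
    then show "\<forall>\<^sub>F k in sequentially. e < (norm (?g k - q))\<^sup>2"
      by (intro always_eventually allI less_le_trans[OF _ zero_le_power2])
  next
    fix e :: real assume e: "0 < e"
    \<comment> \<open>The limit \<open>q\<close> may lie outside the domain, where the conjugate is
      infinite. A domain point \<open>p\<close> of nearly the same norm replaces it, at a cost below
      \<open>e / 2\<close>.\<close>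
    have "open {p. (norm p)\<^sup>2 < (norm q)\<^sup>2 + e / 2}"
      by (intro open_Collect_less continuous_intros)
    moreover have "q \<in> {p. (norm p)\<^sup>2 < (norm q)\<^sup>2 + e / 2}" "q \<in> closure (conj_dom f)"
      using e q by (auto simp: is_arg_min_linorder)
    ultimately have "{p. (norm p)\<^sup>2 < (norm q)\<^sup>2 + e / 2} \<inter> conj_dom f \<noteq> {}"
      using open_Int_closure_eq_empty by blast
    then obtain p where p: "p \<in> conj_dom f" "(norm p)\<^sup>2 < (norm q)\<^sup>2 + e / 2"
      by blast
    obtain r where r: "\<And>y. 0 \<le> f y + r - p \<bullet> y"
      using conj_dom_dual_div[OF p(1)] by blast
    let ?D = "2 * (f (x 0) + r - p \<bullet> x 0)" and ?a = "\<lambda>k. \<Sum>i<k. \<eta> i"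
    \<comment> \<open>As \<open>p\<close> is fixed once \<open>e\<close> is, \<open>?D\<close> does
      not vary with \<open>k\<close>.\<close>
    have "(\<lambda>k. ?D / ?a k) \<longlonglongrightarrow> 0"
      by (intro real_tendsto_divide_at_top[OF tendsto_const lim])
    then have "\<forall>\<^sub>F k in sequentially. ?D / ?a k < e / 2"
      using e by (intro order_tendstoD) auto
    moreover have "\<forall>\<^sub>F k in sequentially. ?a k > 0"
      using lim by (simp add: filterlim_at_top_dense)
    ultimately show "\<forall>\<^sub>F k in sequentially. (norm (?g k - q))\<^sup>2 < e"
    proof eventually_elim
      case (elim k)
      have "(norm (?g k))\<^sup>2 - (norm p)\<^sup>2 \<le> ?D / ?a k"
        using gradient_descent_norm_bound[where x = x and \<eta> = \<eta> and p = p and r = r, OF assms(1,2) x \<eta> r, of k] elim(2)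
        by (simp add: pos_le_divide_eq mult.commute)
      then show ?case
        using elim(1) p(2) dist[of k] by linarith
    qed
  qed
  then have "(\<lambda>k. sqrt ((norm (?g k - q))\<^sup>2)) \<longlonglongrightarrow> sqrt 0"
    by (rule tendsto_real_sqrt)
  then show ?thesis
    by (simp add: LIM_zero_iff tendsto_norm_zero_iff)
qed

section \<open>Rates and limit for the whole trajectory\<close>

theorem corollary3p5:
  fixes f :: "real ^ 'n \<Rightarrow> real" and L :: real and x0 :: "real ^ 'n"
    and x :: "nat \<Rightarrow> real ^ 'n" and \<eta> a :: "nat \<Rightarrow> real"
  assumes "L > 0"
    and "f \<in> convex_smooth L"
    and "x 0 = x0"
    and "\<And>k. x (Suc k) = x k - \<eta> k *\<^sub>R gradient f (x k)"
    and "\<And>i. 0 < \<eta> i \<and> \<eta> i \<le> 1 / L"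
    and "\<And>k. a k = (\<Sum>i<k. \<eta> i)"
  shows
    "((\<forall>i. \<eta> i = 1 / L) \<longrightarrow>
       (\<forall>p\<in>conj_dom f. \<forall>k\<ge>1.
          ereal ((norm (gradient f (x k)))\<^sup>2 - (norm p)\<^sup>2)
            \<le> ereal (2 * L) * dual_div f x0 p / ereal (real k))) \<and>
     (filterlim a at_top sequentially \<longrightarrow>
       (\<lambda>k. gradient f (x k)) \<longlonglongrightarrow> arg_min norm (\<lambda>p. p \<in> closure (conj_dom f))) \<and>
     (\<forall>ps. is_arg_min norm (\<lambda>p. p \<in> conj_dom f) ps \<longrightarrow>
       (\<forall>k\<ge>1. ereal ((norm (gradient f (x k) - ps))\<^sup>2) \<le> 2 * dual_div f x0 ps / ereal (a k))) \<and>
     (\<forall>ps. is_arg_min norm (\<lambda>p. p \<in> conj_dom f) ps \<and> (\<forall>i. \<eta> i = 1 / L) \<longrightarrow>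
       (\<forall>k\<ge>1. (norm (gradient f (x k) - ps))\<^sup>2 \<le> (norm (gradient f (x k)))\<^sup>2 - (norm ps)\<^sup>2 \<and>
          ereal ((norm (gradient f (x k)))\<^sup>2 - (norm ps)\<^sup>2)
            \<le> ereal (2 * L) * dual_div f x0 ps / ereal (real k)))"
proof -
  let ?g = "\<lambda>k. gradient f (x k)"
  note f = \<open>f \<in> convex_smooth L\<close> and a = \<open>\<And>k. a k = (\<Sum>i<k. \<eta> i)\<close>
  note descent = \<open>L > 0\<close> f \<open>\<And>k. x (Suc k) = x k - \<eta> k *\<^sub>R gradient f (x k)\<close>
    \<open>\<And>i. 0 < \<eta> i \<and> \<eta> i \<le> 1 / L\<close>
  have bound: "ereal ((norm (?g k))\<^sup>2 - (norm p)\<^sup>2) \<le> 2 * dual_div f x0 p / ereal (a k)"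
    if "p \<in> conj_dom f" "k \<ge> 1" for p k
  proof -
    obtain r where r: "\<And>y. dual_div f y p = ereal (f y + r - p \<bullet> y)" "\<And>y. 0 \<le> f y + r - p \<bullet> y"
      using conj_dom_dual_div[OF \<open>p \<in> conj_dom f\<close>] by blast
    \<comment> \<open>At \<open>k = 0\<close> the sum is empty; \<open>k \<ge> 1\<close> allows the
      division.\<close>
    have "a k > 0"
      unfolding a using descent(4) \<open>k \<ge> 1\<close> by (intro sum_pos) (auto simp: lessThan_empty_iff)
    moreover have "a k * ((norm (?g k))\<^sup>2 - (norm p)\<^sup>2) \<le> 2 * (f x0 + r - p \<bullet> x0)"
      using gradient_descent_norm_bound[where x = x and \<eta> = \<eta> and p = p and r = r, OF descent r(2)] \<open>x 0 = x0\<close> a by simp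
    ultimately have "(norm (?g k))\<^sup>2 - (norm p)\<^sup>2 \<le> 2 * (f x0 + r - p \<bullet> x0) / a k"
      by (simp add: pos_le_divide_eq mult.commute)
    moreover have "2 * dual_div f x0 p / ereal (a k) = ereal (2 * (f x0 + r - p \<bullet> x0) / a k)"
      using \<open>a k > 0\<close> by (simp add: r(1))
    ultimately show ?thesis
      by simp
  qed
  have const: "2 * dual_div f x0 p / ereal (a k) = ereal (2 * L) * dual_div f x0 p / ereal (real k)"
    if p: "p \<in> conj_dom f" and "k \<ge> 1" and "\<forall>i. \<eta> i = 1 / L" for p k
  proof -
    obtain r where r: "\<And>y. dual_div f y p = ereal (f y + r - p \<bullet> y)" "\<And>y. 0 \<le> f y + r - p \<bullet> y"
      using conj_dom_dual_div[OF p] by blast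
    \<comment> \<open>For constant steps \<open>a k\<close> equals \<open>k / L\<close>.\<close>
    have "2 * (f x0 + r - p \<bullet> x0) / a k = 2 * L * (f x0 + r - p \<bullet> x0) / real k"
      using a that(3) by simp
    moreover have "a k \<noteq> 0"
      using a that(2,3) \<open>L > 0\<close> by simp
    ultimately show ?thesis
      using \<open>k \<ge> 1\<close> by (simp add: r(1))
  qed
  have dist: "(norm (?g k - ps))\<^sup>2 \<le> (norm (?g k))\<^sup>2 - (norm ps)\<^sup>2"
    if "is_arg_min norm (\<lambda>p. p \<in> conj_dom f) ps" for ps k
    using f gradient_in_conj_dom[of f] dist_min_norm_point_le[OF convex_conj_dom that]
    by (auto simp: convex_smooth_def)
  have min_in_dom: "ps \<in> conj_dom f" if "is_arg_min norm (\<lambda>p. p \<in> conj_dom f) ps" for ps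
    using that by (simp add: is_arg_min_linorder)
  \<comment> \<open>Existence of a minimizer ensures that the choice operator returns one.\<close>
  have closure_min: "is_arg_min norm (\<lambda>p. p \<in> closure (conj_dom f))
      (arg_min norm (\<lambda>p. p \<in> closure (conj_dom f)))"
    using ex1_min_norm_closure_conj_dom[OF f] unfolding arg_min_def by (rule someI2_ex[OF ex1_implies_ex])
  have limit: "?g \<longlonglongrightarrow> arg_min norm (\<lambda>p. p \<in> closure (conj_dom f))"
    if "filterlim a at_top sequentially"
    using gradient_descent_gradient_tendsto[where x = x and \<eta> = \<eta>, OF descent _ closure_min] that
    by (simp add: ext[of a, OF a])
  show ?thesis
  proof (intro conjI allI impI ballI; (elim conjE)?)
    fix p k assume "\<forall>i. \<eta> i = 1 / L" "p \<in> conj_dom f" "1 \<le> (k::nat)"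
    then show "ereal ((norm (?g k))\<^sup>2 - (norm p)\<^sup>2)
        \<le> ereal (2 * L) * dual_div f x0 p / ereal (real k)"
      using bound const by metis
  next
    assume "filterlim a at_top sequentially"
    then show "?g \<longlonglongrightarrow> arg_min norm (\<lambda>p. p \<in> closure (conj_dom f))"
      by (rule limit)
  next
    fix ps k assume ps: "is_arg_min norm (\<lambda>p. p \<in> conj_dom f) ps" and "1 \<le> (k::nat)"
    have "ereal ((norm (?g k - ps))\<^sup>2) \<le> ereal ((norm (?g k))\<^sup>2 - (norm ps)\<^sup>2)"
      using dist[OF ps] by simp
    also have "\<dots> \<le> 2 * dual_div f x0 ps / ereal (a k)"
      using bound[OF min_in_dom[OF ps] \<open>1 \<le> k\<close>] .
    finally show "ereal ((norm (?g k - ps))\<^sup>2) \<le> 2 * dual_div f x0 ps / ereal (a k)" .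
  next
    fix ps k assume "is_arg_min norm (\<lambda>p. p \<in> conj_dom f) ps"
    then show "(norm (?g k - ps))\<^sup>2 \<le> (norm (?g k))\<^sup>2 - (norm ps)\<^sup>2"
      by (rule dist)
  next
    fix ps k assume "is_arg_min norm (\<lambda>p. p \<in> conj_dom f) ps" "\<forall>i. \<eta> i = 1 / L" "1 \<le> (k::nat)"
    then show "ereal ((norm (?g k))\<^sup>2 - (norm ps)\<^sup>2)
        \<le> ereal (2 * L) * dual_div f x0 ps / ereal (real k)"
      using bound const min_in_dom by metis
  qed
qed

end
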